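(* Let $G$ be a connected graph and let $H$ be any graph (not necessarily connected). Then \[ \pi(G\bowtie H)\leq |G|\,|H| + 4\,\pi(G). \]
   Context: All graphs are finite, simple, and have at least one vertex; $|G|$ denotes the number of vertices of $G$. A configuration on a connected graph $F$ is a placement of pebbles on its vertices (a function $V(F)\to\mathbb{Z}_{\ge 0}$); its size is the total number of pebbles. A pebbling move removes two pebbles from a vertex $u$ carrying at least two pebbles and places one pebble on a vertex adjacent to $u$. Given a root vertex $r$, a configuration is $r$-solvable if, after some finite (possibly empty) sequence of pebbling moves, there is at least one pebble on $r$. The pebbling number $\pi(F)$ is the least number $n$ such that, for every root $r\in V(F)$, every configuration of size $n$ is $r$-solvable. The corona $G\bowtie H$ is obtained from one copy of $G$ and $|G|$ disjoint copies of $H$, one for each vertex of $G$, by joining each vertex of $G$ to all vertices of its own copy of $H$. Precisely, its vertex set is the disjoint union $V(G)\cup (V(G)\times V(H))$, and its adjacencies are: $g\sim g'$ whenever $g,g'$ are adjacent in $G$; $g\sim (g,h)$ for all $g\in V(G)$, $h\in V(H)$; and $(g,h)\sim (g,h')$ whenever $h,h'$ are adjacent in $H$. *)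

theory Defs
  imports "Graph_Theory.Digraph_Component"
begin

text \<open>
  Finite simple graphs are the \<^locale>\<open>pair_graph\<close>s: finite, loop-free, symmetric digraphs whose
  arcs are pairs of vertices, an edge being represented by its two opposite arcs. This locale
  admits the null graph. The library's \<^const>\<open>connected\<close> excludes it.
\<close>

text \<open>
  The function type is wider than \<open>V(F) \<rightarrow> nat\<close>, so a configuration is required to vanish
  off the vertex set.
\<close>

definition configuration :: "'a pair_pre_digraph \<Rightarrow> ('a \<Rightarrow> nat) \<Rightarrow> bool" where
  "configuration F c \<longleftrightarrow> (\<forall>v. v \<notin> pverts F \<longrightarrow> c v = 0)"

definition config_size :: "'a pair_pre_digraph \<Rightarrow> ('a \<Rightarrow> nat) \<Rightarrow> nat" where
  "config_size F c = (\<Sum>v\<in>pverts F. c v)"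

definition pebbling_move :: "'a pair_pre_digraph \<Rightarrow> ('a \<Rightarrow> nat) \<Rightarrow> ('a \<Rightarrow> nat) \<Rightarrow> bool" where
  "pebbling_move F c c' \<longleftrightarrow>
     (\<exists>u v. (u, v) \<in> parcs F \<and> 2 \<le> c u \<and> c' = c(u := c u - 2, v := c v + 1))"

definition solvable :: "'a pair_pre_digraph \<Rightarrow> 'a \<Rightarrow> ('a \<Rightarrow> nat) \<Rightarrow> bool" where
  "solvable F r c \<longleftrightarrow> (\<exists>c'. (pebbling_move F)\<^sup>*\<^sup>* c c' \<and> 1 \<le> c' r)"

text \<open>
  Meaningful for connected graphs only: on a disconnected graph no \<open>n\<close> qualifies, and
  \<open>LEAST\<close> returns an unspecified number.
\<close>

definition pebbling_number :: "'a pair_pre_digraph \<Rightarrow> nat" where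
  "pebbling_number F =
     (LEAST n. \<forall>r\<in>pverts F. \<forall>c. configuration F c \<and> config_size F c = n \<longrightarrow> solvable F r c)"

text \<open>
  \<open>Inl g\<close> is the vertex \<open>g\<close> of \<open>G\<close>, and \<open>Inr (g, h)\<close> is the vertex \<open>h\<close> in the copy of \<open>H\<close> at \<open>g\<close>.
\<close>

definition corona ::
  "'a pair_pre_digraph \<Rightarrow> 'b pair_pre_digraph \<Rightarrow> ('a + 'a \<times> 'b) pair_pre_digraph" where
  "corona G H =
     \<lparr> pverts = pverts G <+> pverts G \<times> pverts H,
       parcs =
         {(Inl g, Inl g') | g g'. (g, g') \<in> parcs G}
         \<union> {(Inl g, Inr (g, h)) | g h. g \<in> pverts G \<and> h \<in> pverts H}
         \<union> {(Inr (g, h), Inl g) | g h. g \<in> pverts G \<and> h \<in> pverts H}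
         \<union> {(Inr (g, h), Inr (g, h')) | g h h'. g \<in> pverts G \<and> (h, h') \<in> parcs H} \<rparr>"

lemma pair_graph_corona:
  assumes "pair_graph G" and "pair_graph H"
  shows "pair_graph (corona G H)"
proof -
  interpret G: pair_graph G by fact
  interpret H: pair_graph H by fact
  let ?V = "pverts (corona G H)"
  have V: "finite ?V"
    by (simp add: corona_def)
  have A: "e \<in> ?V \<times> ?V \<and> fst e \<noteq> snd e" if "e \<in> parcs (corona G H)" for e
    using that by (auto simp: corona_def dest: G.in_arcsD1 G.in_arcsD2 H.in_arcsD1 H.in_arcsD2
        G.no_loops' H.no_loops')
  have F: "finite (parcs (corona G H))"
    by (rule finite_subset[of _ "?V \<times> ?V"]) (use A V in auto)
  have S: "sym (parcs (corona G H))"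
    by (auto simp: corona_def sym_def intro: G.arcs_symmetric H.arcs_symmetric)
  show ?thesis
    by unfold_locales (use V F S A in \<open>auto simp: symmetric_def mem_Times_iff\<close>)
qed

end

theory Submission
  imports Defs
begin

text \<open>
  Spend pebbles lying in pairs inside the copies of \<open>H\<close>: as long as some vertex of a copy carries
  two pebbles, move one pebble from there to its vertex of \<open>G\<close>. Such a move leaves the number of
  pebbles on the copies plus twice the number of pebbles on \<open>G\<close> unchanged
  (\<open>collect_on_base\<close>). At the end each of the \<open>|G||H|\<close> vertices in the copies carries at most one
  pebble, so from a configuration of size \<open>|G||H| + 4\<pi>(G)\<close> at least \<open>2\<pi>(G)\<close> pebbles arrive on \<open>G\<close>.

  These split into two disjoint configurations of \<open>G\<close> of size at least \<open>\<pi>(G)\<close>, and each of them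
  brings a pebble to any chosen vertex \<open>g\<close> of \<open>G\<close>; together they bring two
  (\<open>two_pebbles_on_root\<close>). If \<open>g\<close> is the root, this is more than enough, and if the root is
  \<open>(g, h)\<close>, one more move reaches it.

  That every configuration with at least \<open>\<pi>(G)\<close> pebbles is solvable requires the
  minimum defining \<open>\<pi>(G)\<close> to exist, which is where connectedness of \<open>G\<close> enters
  (\<open>pebbling_number_solvable\<close>).
\<close>

section \<open>Pebbling moves in the presence of further pebbles\<close>

lemma pebbling_move_add:
  assumes "pebbling_move F c c'"
  shows "pebbling_move F (\<lambda>v. c v + d v) (\<lambda>v. c' v + d v)"
proof -
  from assms obtain u v where uv: "(u, v) \<in> parcs F" "2 \<le> c u"
    and c': "c' = c(u := c u - 2, v := c v + 1)"
    by (auto simp: pebbling_move_def)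
  let ?cd = "\<lambda>v. c v + d v"
  have "(\<lambda>v. c' v + d v) = ?cd(u := ?cd u - 2, v := ?cd v + 1)"
    using uv(2) by (auto simp: c' fun_eq_iff)
  with uv show ?thesis
    unfolding pebbling_move_def by (intro exI[of _ u] exI[of _ v]) simp
qed

lemma pebbling_moves_add:
  assumes "(pebbling_move F)\<^sup>*\<^sup>* c c'"
  shows "(pebbling_move F)\<^sup>*\<^sup>* (\<lambda>v. c v + d v) (\<lambda>v. c' v + d v)"
  using assms
  by induction (auto intro: rtranclp.rtrancl_into_rtrancl pebbling_move_add)

lemma pebbling_moves_add_both:
  assumes "(pebbling_move F)\<^sup>*\<^sup>* c c'" and "(pebbling_move F)\<^sup>*\<^sup>* d d'"
  shows "(pebbling_move F)\<^sup>*\<^sup>* (\<lambda>v. c v + d v) (\<lambda>v. c' v + d' v)"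
proof -
  have "(pebbling_move F)\<^sup>*\<^sup>* (\<lambda>v. c v + d v) (\<lambda>v. c' v + d v)"
    using assms(1) by (rule pebbling_moves_add)
  also have "(pebbling_move F)\<^sup>*\<^sup>* (\<lambda>v. c' v + d v) (\<lambda>v. c' v + d' v)"
    using pebbling_moves_add[OF assms(2), of c'] by (simp add: add.commute)
  finally show ?thesis .
qed

lemma solvable_mono:
  assumes "solvable F r c" and "\<And>v. c v \<le> d v"
  shows "solvable F r d"
proof -
  from assms(1) obtain c' where c': "(pebbling_move F)\<^sup>*\<^sup>* c c'" "1 \<le> c' r"
    by (auto simp: solvable_def)
  have "(\<lambda>v. c v + (d v - c v)) = d"
    using assms(2) by simp
  with pebbling_moves_add[OF c'(1), of "\<lambda>v. d v - c v"] c'(2) show ?thesis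
    by (fastforce simp: solvable_def)
qed

lemma solvable_rtranclp:
  assumes "(pebbling_move F)\<^sup>*\<^sup>* c c'" and "solvable F r c'"
  shows "solvable F r c"
  using assms unfolding solvable_def by (meson rtranclp_trans)

text \<open>
  The pebbling number speaks of configurations of one exact size; this lemma cuts a larger one down
  to that size.
\<close>

lemma exists_subconfiguration:
  assumes "finite (pverts F)" and "n \<le> config_size F c"
  obtains c' where "configuration F c'" "config_size F c' = n" "\<And>v. c' v \<le> c v"
proof -
  have "\<exists>c'. configuration F c' \<and> config_size F c' = n \<and> (\<forall>v. c' v \<le> c v)"
    using assms(2)
  proof (induction n)
    case 0
    show ?case
      by (rule exI[of _ "\<lambda>_. 0"]) (simp add: configuration_def config_size_def)
  next
    case (Suc n)
    then obtain c' where c': "configuration F c'" "config_size F c' = n" "\<forall>v. c' v \<le> c v"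
      by auto
    have "\<exists>v\<in>pverts F. c' v < c v"
    proof (rule ccontr)
      assume "\<not> ?thesis"
      then have "config_size F c \<le> config_size F c'"
        unfolding config_size_def by (intro sum_mono) (auto simp: not_less)
      with Suc.prems c'(2) show False
        by simp
    qed
    then obtain v where v: "v \<in> pverts F" "c' v < c v" ..
    have "config_size F (c'(v := Suc (c' v))) = Suc (config_size F c')"
      using assms(1) v(1) by (simp add: config_size_def sum.remove)
    moreover have "configuration F (c'(v := Suc (c' v)))"
      using c'(1) v(1) by (simp add: configuration_def)
    moreover have "\<forall>w. (c'(v := Suc (c' v))) w \<le> c w"
      using c'(3) v(2) by auto
    ultimately show ?case
      using c'(2) by blast
  qed
  with that show thesis by blast
qed

section \<open>The pebbling number of a connected graph\<close>

lemma pebbling_moves_along_arc: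
  assumes "(u, w) \<in> parcs F" and "u \<noteq> w" and "2 * k \<le> c u"
  shows "(pebbling_move F)\<^sup>*\<^sup>* c (c(u := c u - 2 * k, w := c w + k))"
  using assms(3)
proof (induction k)
  case 0
  show ?case by simp
next
  case (Suc k)
  let ?c = "c(u := c u - 2 * k, w := c w + k)"
  have "c(u := c u - 2 * Suc k, w := c w + Suc k) = ?c(u := ?c u - 2, w := ?c w + 1)"
    using assms(2) by auto
  then have "pebbling_move F ?c (c(u := c u - 2 * Suc k, w := c w + Suc k))"
    unfolding pebbling_move_def using assms(1,2) Suc.prems
    by (intro exI[of _ u] exI[of _ w]) auto
  moreover have "(pebbling_move F)\<^sup>*\<^sup>* c ?c"
    using Suc.prems by (intro Suc.IH) simp
  ultimately show ?case
    by (rule rtranclp.rtrancl_into_rtrancl[rotated])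
qed

text \<open>
  Each step of a walk towards \<open>r\<close> costs half of the pebbles, so doubling the demand with each arc
  of the walk is enough.
\<close>

lemma exists_solving_amount:
  assumes "pair_graph F" and "u \<rightarrow>\<^sup>*\<^bsub>with_proj F\<^esub> r"
  shows "\<exists>N. \<forall>c. N \<le> c u \<longrightarrow> solvable F r c"
proof -
  interpret pair_graph F by fact
  from assms(2) show ?thesis
  proof (induction rule: converse_reachable_induct)
    case base
    have "1 \<le> c r \<longrightarrow> solvable F r c" for c
      by (auto simp: solvable_def)
    then show ?case by blast
  next
    case (step u w)
    then obtain N where N: "solvable F r c" if "N \<le> c w" for c
      by blast
    from step have uw: "(u, w) \<in> parcs F"
      by simp
    have "u \<noteq> w"
      using uw no_loops' by blast
    then have "solvable F r c" if "2 * N \<le> c u" for c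
      using pebbling_moves_along_arc[OF uw, of N c] that
      by - (rule solvable_rtranclp[OF _ N], auto)
    then show ?case by blast
  qed
qed

text \<open>
  By the pigeonhole principle, in a large configuration some vertex carries enough pebbles to
  reach the root on its own. Hence the set whose least element is the pebbling number is nonempty.
  Configurations with surplus pebbles, also off the vertex set, are covered by \<open>solvable_mono\<close>.
\<close>

lemma pebbling_number_solvable:
  assumes "pair_graph F" and "connected (with_proj F)"
    and r: "r \<in> pverts F" and size: "pebbling_number F \<le> config_size F c"
  shows "solvable F r c"
proof -
  interpret pair_graph F by fact
  have "strongly_connected (with_proj F)"
    using assms(2) by (intro symmetric_connected_imp_strongly_connected) (auto simp: sym_arcs)
  then have "u \<rightarrow>\<^sup>*\<^bsub>with_proj F\<^esub> v" if "u \<in> pverts F" "v \<in> pverts F" for u v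
    using that by (auto elim: strongly_connectedE)
  then have "\<forall>u\<in>pverts F. \<forall>v\<in>pverts F. \<exists>N. \<forall>c. N \<le> c u \<longrightarrow> solvable F v c"
    using exists_solving_amount[OF assms(1)] by blast
  then obtain N where N: "solvable F v c"
    if "u \<in> pverts F" "v \<in> pverts F" "N u v \<le> c u" for u v c
    by metis
  let ?P = "\<lambda>n. \<forall>r\<in>pverts F. \<forall>c. configuration F c \<and> config_size F c = n \<longrightarrow> solvable F r c"
  have "?P (Suc (\<Sum>u\<in>pverts F. \<Sum>v\<in>pverts F. N u v))"
  proof (intro ballI allI impI)
    fix s d
    assume s: "s \<in> pverts F"
      and d: "configuration F d \<and> config_size F d = Suc (\<Sum>u\<in>pverts F. \<Sum>v\<in>pverts F. N u v)"
    have "\<exists>u\<in>pverts F. (\<Sum>v\<in>pverts F. N u v) < d u"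
    proof (rule ccontr)
      assume "\<not> ?thesis"
      then have "config_size F d \<le> (\<Sum>u\<in>pverts F. \<Sum>v\<in>pverts F. N u v)"
        unfolding config_size_def by (intro sum_mono) (auto simp: not_less)
      with d show False by simp
    qed
    then obtain u where u: "u \<in> pverts F" "(\<Sum>v\<in>pverts F. N u v) < d u" ..
    have "N u s \<le> (\<Sum>v\<in>pverts F. N u v)"
      using s by (intro member_le_sum) auto
    with u s show "solvable F s d"
      by (intro N) auto
  qed
  then have P: "?P (pebbling_number F)"
    unfolding pebbling_number_def by (rule LeastI)
  obtain c' where "configuration F c'" "config_size F c' = pebbling_number F" "\<And>v. c' v \<le> c v"
    using exists_subconfiguration[OF _ size] by auto
  with P r show ?thesis
    by (blast intro: solvable_mono)
qed

lemma two_pebbles_on_root: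
  assumes "pair_graph F" and "connected (with_proj F)"
    and r: "r \<in> pverts F" and size: "2 * pebbling_number F \<le> config_size F c"
  obtains c' where "(pebbling_move F)\<^sup>*\<^sup>* c c'" "2 \<le> c' r"
proof -
  interpret pair_graph F by fact
  obtain a where a: "config_size F a = pebbling_number F" "\<And>v. a v \<le> c v"
    using exists_subconfiguration[of F "pebbling_number F" c] size by auto
  define b where "b = (\<lambda>v. c v - a v)"
  have ab: "(\<lambda>v. a v + b v) = c"
    using a(2) by (simp add: b_def)
  have "config_size F a + config_size F b = config_size F (\<lambda>v. a v + b v)"
    by (simp add: config_size_def sum.distrib)
  then have "pebbling_number F \<le> config_size F b"
    using size a(1) by (simp add: ab)
  then obtain a' b' where "(pebbling_move F)\<^sup>*\<^sup>* a a'" "1 \<le> a' r"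
    "(pebbling_move F)\<^sup>*\<^sup>* b b'" "1 \<le> b' r"
    using pebbling_number_solvable[OF assms(1-3)] a(1) unfolding solvable_def by (metis order_refl)
  with pebbling_moves_add_both[of F a a' b b'] that[of "\<lambda>v. a' v + b' v"] show thesis
    by (simp add: ab)
qed

section \<open>Pebbling in the corona\<close>

lemma corona_pebbling_move_on_base:
  assumes "pebbling_move G c c'"
  shows "pebbling_move (corona G H) (case_sum c e) (case_sum c' e)"
proof -
  from assms obtain u v where uv: "(u, v) \<in> parcs G" "2 \<le> c u"
    and c': "c' = c(u := c u - 2, v := c v + 1)"
    by (auto simp: pebbling_move_def)
  let ?d = "case_sum c e"
  have "case_sum c' e = ?d(Inl u := ?d (Inl u) - 2, Inl v := ?d (Inl v) + 1)"
    by (auto simp: c' fun_eq_iff split: sum.split)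
  moreover have "(Inl u, Inl v) \<in> parcs (corona G H)"
    using uv(1) by (auto simp: corona_def)
  ultimately show ?thesis
    unfolding pebbling_move_def using uv(2)
    by (intro exI[of _ "Inl u"] exI[of _ "Inl v"]) simp
qed

lemma corona_pebbling_moves_on_base:
  assumes "(pebbling_move G)\<^sup>*\<^sup>* c c'"
  shows "(pebbling_move (corona G H))\<^sup>*\<^sup>* (case_sum c e) (case_sum c' e)"
  using assms
proof induction
  case base
  show ?case by simp
next
  case (step c' c'')
  show ?case
    using step.IH corona_pebbling_move_on_base[OF step.hyps(2), of H e]
    by - (rule rtranclp.rtrancl_into_rtrancl)
qed

text \<open>
  A move from \<open>(g, h)\<close> to \<open>g\<close> takes two pebbles off the copies of \<open>H\<close> and puts one on \<open>G\<close>, so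
  counting the pebbles on \<open>G\<close> twice gives an invariant, and the process stops because the copies
  lose pebbles.
\<close>

lemma collect_on_base:
  assumes "finite (pverts G)" and "finite (pverts H)"
  defines "C \<equiv> pverts G \<times> pverts H"
  shows "\<exists>d'. (pebbling_move (corona G H))\<^sup>*\<^sup>* d d' \<and> (\<forall>q\<in>C. d' (Inr q) \<le> 1) \<and>
    2 * config_size G (d' \<circ> Inl) + sum (d' \<circ> Inr) C =
    2 * config_size G (d \<circ> Inl) + sum (d \<circ> Inr) C"
proof (induction "sum (d \<circ> Inr) C" arbitrary: d rule: less_induct)
  case less
  show ?case
  proof (cases "\<forall>q\<in>C. d (Inr q) \<le> 1")
    case True
    then show ?thesis by blast
  next
    case False
    then obtain g h where gh: "g \<in> pverts G" "h \<in> pverts H" "2 \<le> d (Inr (g, h))"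
      by (auto simp: C_def not_le)
    define d1 where "d1 = d(Inr (g, h) := d (Inr (g, h)) - 2, Inl g := d (Inl g) + 1)"
    have "(Inr (g, h), Inl g) \<in> parcs (corona G H)"
      using gh by (auto simp: corona_def)
    then have move: "pebbling_move (corona G H) d d1"
      unfolding pebbling_move_def d1_def using gh(3) by blast
    have "finite C" "(g, h) \<in> C"
      using assms(1,2) gh by (auto simp: C_def)
    then have copies: "sum (d1 \<circ> Inr) C + 2 = sum (d \<circ> Inr) C"
      using gh(3) by (simp add: d1_def sum.remove)
    have base: "config_size G (d1 \<circ> Inl) = config_size G (d \<circ> Inl) + 1"
      using assms(1) gh(1) by (simp add: config_size_def d1_def sum.remove)
    obtain d' where "(pebbling_move (corona G H))\<^sup>*\<^sup>* d1 d'" "\<forall>q\<in>C. d' (Inr q) \<le> 1"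
      "2 * config_size G (d' \<circ> Inl) + sum (d' \<circ> Inr) C =
       2 * config_size G (d1 \<circ> Inl) + sum (d1 \<circ> Inr) C"
      using less[of d1] copies by auto
    with move copies base show ?thesis
      by (intro exI[of _ d']) (auto intro: converse_rtranclp_into_rtranclp)
  qed
qed

lemma corona_solvable:
  assumes G: "pair_graph G" "connected (with_proj G)" and H: "pair_graph H"
    and r: "r \<in> pverts (corona G H)"
    and size: "card (pverts G) * card (pverts H) + 4 * pebbling_number G
      \<le> config_size (corona G H) d"
  shows "solvable (corona G H) r d"
proof -
  interpret G: pair_graph G by fact
  interpret H: pair_graph H by fact
  let ?C = "pverts G \<times> pverts H"
  obtain d' where d': "(pebbling_move (corona G H))\<^sup>*\<^sup>* d d'" "\<forall>q\<in>?C. d' (Inr q) \<le> 1"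
    and pot: "2 * config_size G (d' \<circ> Inl) + sum (d' \<circ> Inr) ?C =
       2 * config_size G (d \<circ> Inl) + sum (d \<circ> Inr) ?C"
    using collect_on_base[of G H d] by auto
  have "config_size (corona G H) d = config_size G (d \<circ> Inl) + sum (d \<circ> Inr) ?C"
    by (simp add: config_size_def corona_def sum.Plus)
  moreover have "sum (d' \<circ> Inr) ?C \<le> card (pverts G) * card (pverts H)"
    using sum_bounded_above[of ?C "d' \<circ> Inr" 1] d'(2) by (fastforce simp: card_cartesian_product)
  ultimately have base: "2 * pebbling_number G \<le> config_size G (d' \<circ> Inl)"
    using size pot by linarith
  \<comment> \<open>The root or, if the root lies in a copy of \<open>H\<close>, the vertex of \<open>G\<close> joined to that copy.\<close>
  define g where "g = (case r of Inl g \<Rightarrow> g | Inr (g, h) \<Rightarrow> g)"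
  have "g \<in> pverts G"
    using r by (auto simp: g_def corona_def)
  then obtain c where c: "(pebbling_move G)\<^sup>*\<^sup>* (d' \<circ> Inl) c" "2 \<le> c g"
    using two_pebbles_on_root[OF G _ base] by blast
  let ?d = "case_sum c (d' \<circ> Inr)"
  have "case_sum (d' \<circ> Inl) (d' \<circ> Inr) = d'"
    by (auto simp: fun_eq_iff split: sum.split)
  with corona_pebbling_moves_on_base[OF c(1), of H "d' \<circ> Inr"] d'(1)
  have moves: "(pebbling_move (corona G H))\<^sup>*\<^sup>* d ?d"
    by simp
  have "solvable (corona G H) r ?d"
  proof (cases r)
    case (Inl v)
    then show ?thesis
      using c(2) unfolding solvable_def by (intro exI[of _ ?d]) (simp add: g_def)
  next
    case (Inr q)
    then have "(Inl g, r) \<in> parcs (corona G H)"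
      using r by (auto simp: corona_def g_def)
    then have "pebbling_move (corona G H) ?d (?d(Inl g := ?d (Inl g) - 2, r := ?d r + 1))"
      using c(2) unfolding pebbling_move_def by (intro exI[of _ "Inl g"] exI[of _ r]) simp
    then show ?thesis
      by (rule solvable_rtranclp[OF r_into_rtranclp]) (auto simp: solvable_def)
  qed
  with moves show ?thesis
    by (rule solvable_rtranclp)
qed

theorem theorem6p4:
  fixes G :: "'a pair_pre_digraph" and H :: "'b pair_pre_digraph"
  assumes "pair_graph G" and "connected (with_proj G)"
    and "pair_graph H" and "pverts H \<noteq> {}"
  shows "pebbling_number (corona G H)
           \<le> card (pverts G) * card (pverts H) + 4 * pebbling_number G"
  unfolding pebbling_number_def[of "corona G H"]
  using corona_solvable[OF assms(1-3)] by (intro Least_le) auto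

end
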